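(* Let $t$ be a positive integer and $(a_1,b_1),\dots,(a_t,b_t)$ be $t$ couples of positive integers. For $X\subset\mathbb{Z}$ define $\Gamma_0(X)=X$ and, for $1\le s\le t$, $\Gamma_s(X)=a_s\Gamma_{s-1}(X)-b_s\Gamma_{s-1}(X)$. Then there exists a set $A$ of positive integers whose asymptotic density $d(A)=\lim_{n\to\infty}|A\cap\{1,\dots,n\}|/n$ exists and equals $\prod_{i=1}^t\frac{1}{a_i+b_i}$, such that the family $\{\Gamma_s(A)\mid 0\le s\le t\}$ has cardinality $t+1$ (i.e. the sets $\Gamma_0(A),\dots,\Gamma_t(A)$ are pairwise distinct).
   Context: For $X\subset\mathbb{Z}$ and integers $a,b$, $aX-bX=\{ax-bx'\mid x,x'\in X\}$. The set $\Gamma_s(X)$ is the paper's composition $\bigcirc_{j=1}^s\Gamma_{a_j,b_j}(X)$ of the linear operations $\Gamma_{a_j,b_j}(X)=a_jX-b_jX$, with the convention that for $s=0$ it is $X$. *)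

theory Defs
  imports Complex_Main
begin

definition lin_op :: "int \<Rightarrow> int \<Rightarrow> int set \<Rightarrow> int set" where
  "lin_op a b X = {a * x - b * x' | x x'. x \<in> X \<and> x' \<in> X}"

(* The couples are indexed from 1: the values a 0 and b 0 are never used. *)
primrec Gamma_iter :: "(nat \<Rightarrow> int) \<Rightarrow> (nat \<Rightarrow> int) \<Rightarrow> nat \<Rightarrow> int set \<Rightarrow> int set" where
  "Gamma_iter a b 0 X = X"
| "Gamma_iter a b (Suc s) X = lin_op (a (Suc s)) (b (Suc s)) (Gamma_iter a b s X)"

(* "The asymptotic density exists and equals d", as a single convergence statement. *)
definition has_asymptotic_density :: "int set \<Rightarrow> real \<Rightarrow> bool" where
  "has_asymptotic_density A d \<longleftrightarrow>
     (\<lambda>n::nat. real (card (A \<inter> {1..int n})) / real n) \<longlonglongrightarrow> d"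

end

theory Submission
  imports Defs
begin

text \<open>
  Put \<open>D\<^sub>s = (a\<^sub>1 + b\<^sub>1) \<cdots> (a\<^sub>s + b\<^sub>s)\<close> and \<open>m = 2 D\<^sub>t\<close>, and let \<open>A\<close> consist of the positive
  integers congruent to 0 or 1 modulo \<open>m\<close>; its density is \<open>2 / m = 1 / D\<^sub>t\<close>. Modulo \<open>m\<close>, the set
  \<open>\<Gamma>\<^sub>s(A)\<close> lies in an interval of length \<open>D\<^sub>s\<close> whose two endpoints it attains. These intervals are
  nested and strictly increasing, and since \<open>D\<^sub>t < m\<close> the largest one does not wrap around,
  so the sets \<open>\<Gamma>\<^sub>s(A)\<close> are pairwise distinct.
\<close>

section \<open>Counting and density of residue classes\<close>

text \<open>The members are \<open>m * j + r\<close> for the integers \<open>j\<close> between (1 -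
  r) / m and (n - r) / m. Their number differs from the length (n - 1) / m by at most 1, and passing
  to n / m costs at most 1 more.\<close>

lemma card_residue_class_bound:
  fixes m r :: int and n :: nat
  assumes "m > 0"
  shows "\<bar>real (card ({x. x > 0 \<and> m dvd x - r} \<inter> {1..int n})) - real n / real_of_int m\<bar> \<le> 2"
proof -
  define l where "l = \<lceil>(1 - real_of_int r) / real_of_int m\<rceil>"
  define u where "u = \<lfloor>(real n - real_of_int r) / real_of_int m\<rfloor>"
  have m: "real_of_int m \<ge> 1" using assms by simp
  have lower: "l \<le> j \<longleftrightarrow> 1 \<le> m * j + r" for j
  proof -
    have "l \<le> j \<longleftrightarrow> real_of_int 1 \<le> real_of_int (m * j + r)"
      using m by (simp add: l_def ceiling_le_iff field_simps)
    then show ?thesis by (simp only: of_int_le_iff)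
  qed
  have upper: "j \<le> u \<longleftrightarrow> m * j + r \<le> int n" for j
  proof -
    have "j \<le> u \<longleftrightarrow> real_of_int (m * j + r) \<le> real_of_int (int n)"
      using m by (simp add: u_def le_floor_iff field_simps)
    then show ?thesis by (simp only: of_int_le_iff)
  qed
  have eq: "{x. x > 0 \<and> m dvd x - r} \<inter> {1..int n} = (\<lambda>j. m * j + r) ` {l..u}"
  proof (rule set_eqI)
    fix x
    have "m dvd x - r \<longleftrightarrow> (\<exists>j. x = m * j + r)"
      by (auto simp: dvd_def algebra_simps)
    then show "x \<in> {x. x > 0 \<and> m dvd x - r} \<inter> {1..int n} \<longleftrightarrow> x \<in> (\<lambda>j. m * j + r) ` {l..u}"
      by (auto simp: image_iff lower upper)
  qed
  have "inj_on (\<lambda>j. m * j + r) {l..u}"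
    using assms by (simp add: inj_on_def)
  then have card: "card ({x. x > 0 \<and> m dvd x - r} \<inter> {1..int n}) = nat (u - l + 1)"
    by (simp add: eq card_image)
  have split: "(real n - real_of_int r) / real_of_int m - (1 - real_of_int r) / real_of_int m
      = real n / real_of_int m - 1 / real_of_int m"
    by (simp add: diff_divide_distrib)
  have inv: "0 \<le> 1 / real_of_int m" "1 / real_of_int m \<le> 1"
    using m by simp_all
  \<comment> \<open>\<open>nat\<close> sends a negative argument to 0; in that case the estimate
    compares 0 with n / m and uses this sign.\<close>
  have "0 \<le> real n / real_of_int m"
    using m by simp
  then have "\<bar>real (nat (u - l + 1)) - real n / real_of_int m\<bar> \<le> 2"
    using split inv unfolding l_def u_def by linarith
  then show ?thesis by (simp only: card)
qed

lemma has_asymptotic_density_residue_class: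
  fixes m r :: int
  assumes "m > 0"
  shows "has_asymptotic_density {x. x > 0 \<and> m dvd x - r} (1 / real_of_int m)"
proof -
  let ?c = "\<lambda>n::nat. real (card ({x. x > 0 \<and> m dvd x - r} \<inter> {1..int n}))"
  \<comment> \<open>At \<open>n = 0\<close> both quotients by \<open>real n\<close> are 0 by
    convention and the bound would fail, so it is claimed only from 1 on.\<close>
  have bound: "norm (?c n / real n - 1 / real_of_int m) \<le> 2 / real n" if "n > 0" for n
  proof -
    have "?c n / real n - 1 / real_of_int m = (?c n - real n / real_of_int m) / real n"
      using that by (simp add: diff_divide_distrib)
    then show ?thesis
      using card_residue_class_bound[OF assms, where n = n and r = r] that
      by (simp add: divide_right_mono)
  qed
  have "(\<lambda>n. ?c n / real n - 1 / real_of_int m) \<longlonglongrightarrow> 0"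
    by (rule tendsto_0_le[where K = 1, OF lim_const_over_n[of "2::real"]])
      (use bound in \<open>auto intro!: eventually_sequentiallyI[of 1]\<close>)
  then show ?thesis
    unfolding has_asymptotic_density_def by (rule LIM_zero_cancel)
qed

lemma has_asymptotic_density_Un_disjoint:
  assumes "has_asymptotic_density A d" "has_asymptotic_density B e" "A \<inter> B = {}"
  shows "has_asymptotic_density (A \<union> B) (d + e)"
proof -
  have "card ((A \<union> B) \<inter> {1..int n}) = card (A \<inter> {1..int n}) + card (B \<inter> {1..int n})" for n
    using assms(3) by (subst card_Un_disjoint[symmetric]) (auto intro!: arg_cong[where f = card])
  then show ?thesis
    using tendsto_add[OF assms(1,2)[unfolded has_asymptotic_density_def]]
    by (simp add: has_asymptotic_density_def add_divide_distrib)
qed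

section \<open>Intervals spanned modulo \<open>m\<close>\<close>

text \<open>A substitute for minimum and maximum that makes sense for unbounded sets. Residues
  strictly between the endpoints may be missing: extreme values of \<open>lin_op\<close> come from
  extreme values alone.\<close>

definition spans_mod :: "int \<Rightarrow> int set \<Rightarrow> int \<Rightarrow> int \<Rightarrow> bool" where
  "spans_mod m X l h \<longleftrightarrow>
     (\<forall>x\<in>X. \<exists>y\<in>{l..h}. m dvd x - y) \<and> (\<exists>x\<in>X. m dvd x - l) \<and> (\<exists>x\<in>X. m dvd x - h)"

lemma dvd_lin_diff:
  fixes m a b x x' y y' :: int
  assumes "m dvd x - y" "m dvd x' - y'"
  shows "m dvd (a * x - b * x') - (a * y - b * y')"
proof -
  have "(a * x - b * x') - (a * y - b * y') = a * (x - y) - b * (x' - y')"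
    by (simp add: algebra_simps)
  then show ?thesis using assms by simp
qed

text \<open>For positive \<open>a\<close> and \<open>b\<close>, the form
  \<open>a * y - b * y'\<close> on the square of \<open>{l..h}\<close> is least at (l, h) and
  greatest at (h, l); congruences modulo \<open>m\<close> pass through it.\<close>

lemma spans_mod_lin_op:
  assumes X: "spans_mod m X l h" and "a > 0" "b > 0"
  shows "spans_mod m (lin_op a b X) (a * l - b * h) (a * h - b * l)"
proof -
  have near: "\<exists>y\<in>{l..h}. m dvd x - y" if "x \<in> X" for x
    using X that by (simp add: spans_mod_def)
  obtain p q where p: "p \<in> X" "m dvd p - l" and q: "q \<in> X" "m dvd q - h"
    using X unfolding spans_mod_def by (elim conjE bexE)
  have mem: "a * x - b * x' \<in> lin_op a b X" if "x \<in> X" "x' \<in> X" for x x'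
    using that by (auto simp: lin_op_def)
  have "\<exists>z\<in>{a * l - b * h..a * h - b * l}. m dvd (a * x - b * x') - z"
    if xx': "x \<in> X" "x' \<in> X" for x x'
  proof -
    obtain y where y: "y \<in> {l..h}" "m dvd x - y"
      using near[OF xx'(1)] by (elim bexE)
    obtain y' where y': "y' \<in> {l..h}" "m dvd x' - y'"
      using near[OF xx'(2)] by (elim bexE)
    have "a * l \<le> a * y" "a * y \<le> a * h" "b * l \<le> b * y'" "b * y' \<le> b * h"
      using y(1) y'(1) assms(2,3) by simp_all
    then have "a * y - b * y' \<in> {a * l - b * h..a * h - b * l}" by simp
    then show ?thesis
      by (intro bexI[of _ "a * y - b * y'"] dvd_lin_diff y(2) y'(2))
  qed
  moreover have "\<exists>x\<in>lin_op a b X. m dvd x - (a * l - b * h)"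
    by (intro bexI[of _ "a * p - b * q"] dvd_lin_diff mem p q)
  moreover have "\<exists>x\<in>lin_op a b X. m dvd x - (a * h - b * l)"
    by (intro bexI[of _ "a * q - b * p"] dvd_lin_diff mem p q)
  ultimately show ?thesis
    unfolding spans_mod_def by (auto simp: lin_op_def)
qed

text \<open>A member of \<open>X\<close> congruent to an outer endpoint is also congruent to a point
  of the inner interval. Both points lie in an interval shorter than \<open>m\<close>, so they
  coincide, and the outer endpoint belongs to the inner interval.\<close>

lemma spans_mod_unique:
  assumes "spans_mod m X l h" "spans_mod m X l' h'" "l' \<le> l" "h \<le> h'" "h' - l' < m"
  shows "l' = l" "h' = h"
proof -
  have attained: "z \<in> {l..h}" if "z \<in> {l'..h'}" "x \<in> X" "m dvd x - z" for x z
  proof -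
    obtain y where y: "y \<in> {l..h}" "m dvd x - y"
      using assms(1) \<open>x \<in> X\<close> unfolding spans_mod_def by blast
    have "m dvd z - y"
      using dvd_diff[OF y(2) that(3)] by simp
    moreover have "\<bar>z - y\<bar> < m" using y that assms(3-5) by auto
    ultimately have "z = y" using dvd_imp_le_int[of "z - y" m] by fastforce
    then show ?thesis using y by simp
  qed
  obtain p q where pq: "p \<in> X" "m dvd p - l'" "q \<in> X" "m dvd q - h'"
    using assms(2) unfolding spans_mod_def by blast
  \<comment> \<open>\<open>X\<close> is nonempty, so the inner interval is too; hence both outer
    endpoints qualify as \<open>z\<close> in \<open>attained\<close>.\<close>
  have "l' \<le> h'" using assms(1-4) unfolding spans_mod_def by fastforce
  then have "l' \<in> {l..h}" "h' \<in> {l..h}" using attained pq by auto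
  then show "l' = l" "h' = h" using assms(3,4) by auto
qed

section \<open>Endpoints of the iterated intervals\<close>

text \<open>The rule of \<open>spans_mod_lin_op\<close> iterated from [0, 1]. The endpoints are kept
  as integers, not reduced modulo \<open>m\<close>, so that intervals can be compared by
  inclusion.\<close>

primrec Gamma_hull :: "(nat \<Rightarrow> int) \<Rightarrow> (nat \<Rightarrow> int) \<Rightarrow> nat \<Rightarrow> int \<times> int" where
  "Gamma_hull a b 0 = (0, 1)"
| "Gamma_hull a b (Suc s) =
     (a (Suc s) * fst (Gamma_hull a b s) - b (Suc s) * snd (Gamma_hull a b s),
      a (Suc s) * snd (Gamma_hull a b s) - b (Suc s) * fst (Gamma_hull a b s))"

lemma Gamma_hull_width: "snd (Gamma_hull a b s) - fst (Gamma_hull a b s) = (\<Prod>i=1..s. a i + b i)"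
proof (induction s)
  case (Suc s)
  have "snd (Gamma_hull a b (Suc s)) - fst (Gamma_hull a b (Suc s))
      = (snd (Gamma_hull a b s) - fst (Gamma_hull a b s)) * (a (Suc s) + b (Suc s))"
    by (simp add: algebra_simps)
  then show ?case by (simp only: Suc.IH) simp
qed simp

text \<open>These signs persist under the recursion and are what makes the intervals grow.\<close>

lemma Gamma_hull_bounds:
  assumes "\<And>i. i \<in> {1..s} \<Longrightarrow> a i > 0 \<and> b i > 0"
  shows "fst (Gamma_hull a b s) \<le> 0 \<and> 0 < snd (Gamma_hull a b s)"
  using assms
proof (induction s)
  case (Suc s)
  have "a (Suc s) > 0" "b (Suc s) > 0" using Suc.prems by simp_all
  moreover have "fst (Gamma_hull a b s) \<le> 0" "0 < snd (Gamma_hull a b s)" using Suc by auto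
  ultimately have "0 < a (Suc s) * snd (Gamma_hull a b s)" "0 < b (Suc s) * snd (Gamma_hull a b s)"
    "a (Suc s) * fst (Gamma_hull a b s) \<le> 0" "b (Suc s) * fst (Gamma_hull a b s) \<le> 0"
    by (simp_all add: mult_nonneg_nonpos)
  then show ?case by simp
qed simp

text \<open>Multiplying by \<open>a (Suc s)\<close> moves neither endpoint towards 0, and the other
  term pushes outwards. Only the left inequality is strict: the right endpoint stays at 1 in the
  first step if \<open>a 1 = 1\<close>.\<close>

lemma Gamma_hull_step:
  assumes "\<And>i. i \<in> {1..Suc s} \<Longrightarrow> a i > 0 \<and> b i > 0"
  shows "fst (Gamma_hull a b (Suc s)) < fst (Gamma_hull a b s)"
    "snd (Gamma_hull a b s) \<le> snd (Gamma_hull a b (Suc s))"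
proof -
  have ab: "a (Suc s) \<ge> 1" "b (Suc s) \<ge> 1" using assms[of "Suc s"] by simp_all
  have bounds: "fst (Gamma_hull a b s) \<le> 0" "0 < snd (Gamma_hull a b s)"
    using Gamma_hull_bounds[of s a b] assms by auto
  have "a (Suc s) * fst (Gamma_hull a b s) \<le> 1 * fst (Gamma_hull a b s)"
    using ab bounds by (intro mult_right_mono_neg) auto
  moreover have "0 < b (Suc s) * snd (Gamma_hull a b s)" using ab bounds by simp
  ultimately show "fst (Gamma_hull a b (Suc s)) < fst (Gamma_hull a b s)" by simp
  have "1 * snd (Gamma_hull a b s) \<le> a (Suc s) * snd (Gamma_hull a b s)"
    using ab bounds by (intro mult_right_mono) auto
  moreover have "b (Suc s) * fst (Gamma_hull a b s) \<le> 0"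
    using ab bounds by (simp add: mult_nonneg_nonpos)
  ultimately show "snd (Gamma_hull a b s) \<le> snd (Gamma_hull a b (Suc s))" by simp
qed

lemma Gamma_hull_strict_mono:
  assumes "s < r" "\<And>i. i \<in> {1..r} \<Longrightarrow> a i > 0 \<and> b i > 0"
  shows "fst (Gamma_hull a b r) < fst (Gamma_hull a b s) \<and>
    snd (Gamma_hull a b s) \<le> snd (Gamma_hull a b r)"
  using assms
proof (induction r)
  case (Suc r)
  note step = Gamma_hull_step[of r a b, OF Suc.prems(2)]
  show ?case
  proof (cases "s = r")
    case True
    then show ?thesis using step by simp
  next
    case False
    then have "fst (Gamma_hull a b r) < fst (Gamma_hull a b s) \<and>
        snd (Gamma_hull a b s) \<le> snd (Gamma_hull a b r)"
      using Suc by auto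
    then show ?thesis using step by linarith
  qed
qed simp

lemma spans_mod_Gamma_iter:
  assumes "spans_mod m X 0 1" "\<And>i. i \<in> {1..s} \<Longrightarrow> a i > 0 \<and> b i > 0"
  shows "spans_mod m (Gamma_iter a b s X) (fst (Gamma_hull a b s)) (snd (Gamma_hull a b s))"
  using assms(2)
proof (induction s)
  case 0
  then show ?case using assms(1) by simp
next
  case (Suc s)
  then show ?case by (simp add: spans_mod_lin_op)
qed

section \<open>The set of prescribed density and its distinct images\<close>

theorem theorem3p1:
  fixes t :: nat and a b :: "nat \<Rightarrow> int"
  assumes "t > 0"
    and "\<And>i. i \<in> {1..t} \<Longrightarrow> a i > 0 \<and> b i > 0"
  shows "\<exists>A :: int set. (\<forall>x\<in>A. x > 0)
           \<and> has_asymptotic_density A (\<Prod>i=1..t. 1 / real_of_int (a i + b i))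
           \<and> card {Gamma_iter a b s A | s. s \<in> {0..t}} = t + 1"
proof -
  define D where "D = (\<Prod>i=1..t. a i + b i)"
  define m where "m = 2 * D"
  define R where "R r = {x::int. x > 0 \<and> m dvd x - r}" for r
  define A where "A = R 0 \<union> R 1"
  have "D > 0"
    unfolding D_def using assms(2) by (intro prod_pos) (simp add: add_pos_pos)
  then have "m \<ge> 2" by (simp add: m_def)
  have "R 0 \<inter> R 1 = {}"
  proof -
    have "\<not> (m dvd x \<and> m dvd x - 1)" for x
      using dvd_diff[of m x "x - 1"] \<open>m \<ge> 2\<close> by auto
    then show ?thesis by (auto simp: R_def)
  qed
  then have "has_asymptotic_density A (1 / real_of_int m + 1 / real_of_int m)"
    unfolding A_def R_def using \<open>m \<ge> 2\<close>
    by (intro has_asymptotic_density_Un_disjoint has_asymptotic_density_residue_class) auto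
  moreover have "1 / real_of_int m + 1 / real_of_int m = (\<Prod>i=1..t. 1 / real_of_int (a i + b i))"
    by (simp add: m_def D_def prod_dividef)
  ultimately have density: "has_asymptotic_density A (\<Prod>i=1..t. 1 / real_of_int (a i + b i))"
    by simp
  \<comment> \<open>Positive representatives of the two classes; 0 itself is not in
    \<open>A\<close>.\<close>
  have "m \<in> A" "1 \<in> A"
    using \<open>m \<ge> 2\<close> by (auto simp: A_def R_def)
  have span: "spans_mod m A 0 1"
    unfolding spans_mod_def
  proof (intro conjI ballI)
    show "\<exists>y\<in>{0..1}. m dvd x - y" if "x \<in> A" for x
    proof -
      have "m dvd x - 0 \<or> m dvd x - 1"
        using that unfolding A_def R_def by blast
      then show ?thesis
      proof
        assume "m dvd x - 0"
        then show ?thesis by (intro bexI[of _ 0]) simp_all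
      next
        assume "m dvd x - 1"
        then show ?thesis by (intro bexI[of _ 1]) simp_all
      qed
    qed
    show "\<exists>x\<in>A. m dvd x - 0" using \<open>m \<in> A\<close> by (intro bexI[of _ m]) simp_all
    show "\<exists>x\<in>A. m dvd x - 1" using \<open>1 \<in> A\<close> by (intro bexI[of _ 1]) simp_all
  qed
  have distinct: "Gamma_iter a b s A \<noteq> Gamma_iter a b r A" if "s < r" "r \<le> t" for s r
  proof
    assume eq: "Gamma_iter a b s A = Gamma_iter a b r A"
    \<comment> \<open>The interval of index \<open>r\<close> lies in that of index \<open>t\<close>,
      whose width is \<open>D < m\<close>.\<close>
    have "fst (Gamma_hull a b t) \<le> fst (Gamma_hull a b r) \<and>
        snd (Gamma_hull a b r) \<le> snd (Gamma_hull a b t)"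
      using Gamma_hull_strict_mono[of r t a b] assms(2) \<open>r \<le> t\<close> by (cases "r = t") auto
    then have width: "snd (Gamma_hull a b r) - fst (Gamma_hull a b r) < m"
      using Gamma_hull_width[of a b t, folded D_def] \<open>D > 0\<close> unfolding m_def by linarith
    have mono: "fst (Gamma_hull a b r) < fst (Gamma_hull a b s)"
      "snd (Gamma_hull a b s) \<le> snd (Gamma_hull a b r)"
      using Gamma_hull_strict_mono[of s r a b] assms(2) that by auto
    \<comment> \<open>By \<open>eq\<close> a single set spans both nested intervals, the outer one
      shorter than \<open>m\<close>; uniqueness then contradicts the strict inequality of the left
      endpoints.\<close>
    have "spans_mod m (Gamma_iter a b s A) (fst (Gamma_hull a b s)) (snd (Gamma_hull a b s))"
      using spans_mod_Gamma_iter[OF span, of s a b] assms(2) that by auto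
    moreover have "spans_mod m (Gamma_iter a b s A) (fst (Gamma_hull a b r)) (snd (Gamma_hull a b r))"
      using spans_mod_Gamma_iter[OF span, of r a b] assms(2) that unfolding eq by auto
    ultimately have "fst (Gamma_hull a b r) = fst (Gamma_hull a b s)"
      using mono width by (intro spans_mod_unique(1)) auto
    then show False using mono by simp
  qed
  have "inj_on (\<lambda>s. Gamma_iter a b s A) {0..t}"
    by (rule linorder_inj_onI) (use distinct in auto)
  then have "card ((\<lambda>s. Gamma_iter a b s A) ` {0..t}) = t + 1"
    by (simp add: card_image)
  moreover have "{Gamma_iter a b s A | s. s \<in> {0..t}} = (\<lambda>s. Gamma_iter a b s A) ` {0..t}"
    by blast
  moreover have "\<forall>x\<in>A. x > 0" by (auto simp: A_def R_def)
  ultimately show ?thesis using density by auto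
qed

end
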